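(* Let $X$ be a class of permutations and $\mathcal{G}_X=\{G_\pi:\pi\in X\}$ the corresponding class of permutation graphs. If every graph in $\mathcal{G}_X$ is a $2$-letter graph, then $X$ is geometrically griddable.
   Context: Permutation graph: for a permutation $\pi$ of $\{1,\dots,n\}$, $G_\pi$ has vertex set $\{1,\dots,n\}$, with $i$ and $j$ adjacent iff $(i-j)(\pi(i)-\pi(j))<0$. Letter graphs: for a finite alphabet $\Sigma$, a decoder $\mathcal{P}\subseteq\Sigma^2$, and a word $w=w_1\cdots w_n$ over $\Sigma$, the letter graph $G(\mathcal{P},w)$ has vertex set $\{1,\dots,n\}$, where $i<j$ are adjacent iff $(w_i,w_j)\in\mathcal{P}$. A graph is a $k$-letter graph if it is isomorphic to $G(\mathcal{P},w)$ for some alphabet $\Sigma$ with $|\Sigma|\le k$, decoder $\mathcal{P}\subseteq \Sigma^2$ and word $w$ over $\Sigma$. Geometric grid classes: matrices are indexed first by column (left to right) and then by row (bottom to top). For a matrix $M$ with entries in $\{0,1,-1\}$, its standard figure is the subset of $\mathbb{R}^2$ consisting, for each $(k,\ell)$, of the open segment from $(k-1,\ell-1)$ to $(k,\ell)$ if $M_{k,\ell}=1$, or from $(k-1,\ell)$ to $(k,\ell-1)$ if $M_{k,\ell}=-1$. $\mathrm{Geom}(M)$ is the set of permutations obtained by choosing $n$ points on the standard figure, no two on a common horizontal or vertical line, labelling them $1,\dots,n$ from bottom to top, and reading labels left to right. A permutation class is geometrically griddable if it is contained in the union of finitely many geometric grid classes $\mathrm{Geom}(M)$. *)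

theory Defs
  imports "HOL-Analysis.Analysis" "HOL-Combinatorics.Multiset_Permutations" "HOL-Library.Sublist"
begin

text \<open>
  A permutation of \<open>{1, \<dots>, n}\<close> is its one-line notation, a list of length \<open>n\<close>. The empty
  permutation (\<open>n = 0\<close>) is included.
\<close>

definition is_perm :: "nat list \<Rightarrow> bool" where
  "is_perm \<pi> \<longleftrightarrow> \<pi> \<in> permutations_of_set {1..length \<pi>}"

definition perm_at :: "nat list \<Rightarrow> nat \<Rightarrow> nat" where
  "perm_at \<pi> i = \<pi> ! (i - 1)"

definition order_isomorphic :: "nat list \<Rightarrow> nat list \<Rightarrow> bool" where
  "order_isomorphic \<sigma> \<tau> \<longleftrightarrow> length \<sigma> = length \<tau> \<and>
     (\<forall>i<length \<sigma>. \<forall>j<length \<sigma>. \<sigma> ! i < \<sigma> ! j \<longleftrightarrow> \<tau> ! i < \<tau> ! j)"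

definition perm_contained :: "nat list \<Rightarrow> nat list \<Rightarrow> bool" where
  "perm_contained \<sigma> \<pi> \<longleftrightarrow> (\<exists>\<tau>. subseq \<tau> \<pi> \<and> order_isomorphic \<sigma> \<tau>)"

definition perm_class :: "nat list set \<Rightarrow> bool" where
  "perm_class X \<longleftrightarrow> (\<forall>\<pi>\<in>X. is_perm \<pi>) \<and>
     (\<forall>\<pi>\<in>X. \<forall>\<sigma>. is_perm \<sigma> \<and> perm_contained \<sigma> \<pi> \<longrightarrow> \<sigma> \<in> X)"

text \<open>A simple graph is a pair of its vertex set and its set of two-element edges.\<close>

type_synonym 'v graph = "'v set \<times> 'v set set"

definition graph_isomorphic :: "'v graph \<Rightarrow> 'u graph \<Rightarrow> bool" where
  "graph_isomorphic G H \<longleftrightarrow> (\<exists>f. bij_betw f (fst G) (fst H) \<and>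
     (\<forall>u\<in>fst G. \<forall>v\<in>fst G. {u, v} \<in> snd G \<longleftrightarrow> {f u, f v} \<in> snd H))"

definition perm_graph :: "nat list \<Rightarrow> nat graph" where
  "perm_graph \<pi> = ({1..length \<pi>},
     {{i, j} | i j. i \<in> {1..length \<pi>} \<and> j \<in> {1..length \<pi>} \<and>
        (int i - int j) * (int (perm_at \<pi> i) - int (perm_at \<pi> j)) < 0})"

definition perm_graphs :: "nat list set \<Rightarrow> nat graph set" where
  "perm_graphs X = perm_graph ` X"

definition letter_graph :: "('a \<times> 'a) set \<Rightarrow> 'a list \<Rightarrow> nat graph" where
  "letter_graph P w = ({1..length w},
     {{i, j} | i j. i \<in> {1..length w} \<and> j \<in> {1..length w} \<and> i < j \<and>
        (w ! (i - 1), w ! (j - 1)) \<in> P})"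

text \<open>
  HOL cannot quantify over the type of the letters; every finite alphabet is in bijection with a
  finite set of natural numbers, so these are used as alphabets.
\<close>

definition is_letter_graph :: "nat \<Rightarrow> 'v graph \<Rightarrow> bool" where
  "is_letter_graph k G \<longleftrightarrow>
     (\<exists>(\<Sigma> :: nat set) P w. finite \<Sigma> \<and> card \<Sigma> \<le> k \<and> P \<subseteq> \<Sigma> \<times> \<Sigma> \<and> set w \<subseteq> \<Sigma> \<and>
        graph_isomorphic G (letter_graph P w))"

text \<open>
  \<open>(t, u, M)\<close> is a matrix with \<open>t\<close> columns, numbered from left to right, and \<open>u\<close> rows, numbered
  from bottom to top; \<open>M k l\<close> is the entry in column \<open>k\<close> and row \<open>l\<close>, both counted from 1. Values
  of \<open>M\<close> outside this range are irrelevant.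
\<close>

type_synonym grid_matrix = "nat \<times> nat \<times> (nat \<Rightarrow> nat \<Rightarrow> int)"

definition is_grid_matrix :: "grid_matrix \<Rightarrow> bool" where
  "is_grid_matrix = (\<lambda>(t, u, M). \<forall>k\<in>{1..t}. \<forall>l\<in>{1..u}. M k l \<in> {0, 1, -1})"

definition cell_figure :: "int \<Rightarrow> nat \<Rightarrow> nat \<Rightarrow> (real \<times> real) set" where
  "cell_figure m k l =
     (if m = 1 then open_segment (real k - 1, real l - 1) (real k, real l)
      else if m = -1 then open_segment (real k - 1, real l) (real k, real l - 1)
      else {})"

definition standard_figure :: "grid_matrix \<Rightarrow> (real \<times> real) set" where
  "standard_figure = (\<lambda>(t, u, M). \<Union>k\<in>{1..t}. \<Union>l\<in>{1..u}. cell_figure (M k l) k l)"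

text \<open>
  For points listed from left to right: the label of a point is its rank from bottom to top.
\<close>

definition perm_of_points :: "(real \<times> real) list \<Rightarrow> nat list" where
  "perm_of_points ps = map (\<lambda>p. card {q \<in> set ps. snd q \<le> snd p}) ps"

definition Geom :: "grid_matrix \<Rightarrow> nat list set" where
  "Geom M = {perm_of_points ps | ps. set ps \<subseteq> standard_figure M \<and>
     sorted_wrt (\<lambda>p q. fst p < fst q) ps \<and> distinct (map snd ps)}"

definition geometrically_griddable :: "nat list set \<Rightarrow> bool" where
  "geometrically_griddable X \<longleftrightarrow>
     (\<exists>\<M>. finite \<M> \<and> (\<forall>M\<in>\<M>. is_grid_matrix M) \<and> X \<subseteq> (\<Union>M\<in>\<M>. Geom M))"

end

theory Submission
  imports Defs
begin

text \<open>
  The graph of a permutation in \<open>X\<close> has its vertices split into two homogeneous sets \<open>A\<close> and \<open>B\<close>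
  (each a clique or independent), and a linear order \<open>p\<close> such that \<open>a \<in> A\<close> and \<open>b \<in> B\<close> are
  adjacent iff \<open>a\<close> precedes \<open>b\<close>. If \<open>A\<close> and \<open>B\<close> are both independent, then a single vertical or a
  single horizontal line separates the two ends of every inversion, since otherwise \<open>p\<close> would
  contain a cycle; hence the permutation lies in \<open>Geom\<close> of two increasing cells placed side by side
  or on top of each other. Two cliques are dealt with by reflection. If \<open>A\<close> is independent and \<open>B\<close>
  is a clique, then the permutation can be drawn on the figure X, with the \<open>p\<close>-least entry at the
  centre and the distance from the centre growing along \<open>p\<close>.
\<close>

section \<open>Drawing point sets on standard figures\<close>

text \<open>The logistic function: it fits integer coordinates into an open unit cell without
  disturbing their order. Its symmetry \<open>squash_minus\<close> lets decreasing cells be treated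
  like increasing ones.\<close>

definition squash :: "real \<Rightarrow> real" where
  "squash z = 1 / (1 + exp (- z))"

lemma squash_pos: "0 < squash z" and squash_less_1: "squash z < 1"
  by (simp_all add: squash_def add_pos_pos)

lemma squash_strict_mono: "z < z' \<Longrightarrow> squash z < squash z'"
  by (simp add: squash_def field_simps add_pos_pos)

lemma squash_minus: "squash (- z) = 1 - squash z"
proof -
  have "1 + exp z \<noteq> 0" using exp_gt_zero[of z] by linarith
  then show ?thesis by (simp add: squash_def exp_minus field_simps)
qed

lemma increasing_cellI:
  assumes "0 < s" "s < 1"
  shows "(real k - 1 + s, real l - 1 + s) \<in> cell_figure 1 k l"
  using assms by (auto simp: cell_figure_def in_segment algebra_simps intro!: exI[of _ s])

lemma decreasing_cellI:
  assumes "0 < s" "s < 1"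
  shows "(real k - 1 + s, real l - s) \<in> cell_figure (-1) k l"
  using assms by (auto simp: cell_figure_def in_segment algebra_simps intro!: exI[of _ s])

lemma standard_figureI:
  assumes "z \<in> cell_figure (M k l) k l" "k \<in> {1..t}" "l \<in> {1..u}"
  shows "z \<in> standard_figure (t, u, M)"
  using assms unfolding standard_figure_def by blast

lemma cell_figure_swap:
  assumes ab: "(a, b) \<in> cell_figure m k l"
  shows "(b, a) \<in> cell_figure m l k"
proof -
  have swap: "(d, c) \<in> open_segment (b1, a1) (b2, a2)"
    if "(c, d) \<in> open_segment (a1, b1) (a2, b2)" for a1 a2 b1 b2 c d :: real
    using that by (auto simp: in_segment)
  consider "m = 1" | "m = -1"
    using ab unfolding cell_figure_def by (metis empty_iff)
  then show ?thesis
  proof cases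
    case 1
    then show ?thesis using ab by (simp add: cell_figure_def swap)
  next
    case 2
    then have "(b, a) \<in> open_segment (real l, real k - 1) (real l - 1, real k)"
      using ab by (simp add: cell_figure_def swap)
    then show ?thesis using 2 by (simp add: cell_figure_def open_segment_commute)
  qed
qed

text \<open>A drawing only has to respect the order of each coordinate. Abstract vertices with
  integer coordinates turn transposition and reflection of the plot into substitutions for
  \<open>x\<close> and \<open>y\<close>.\<close>

definition drawable :: "('v \<Rightarrow> int) \<Rightarrow> ('v \<Rightarrow> int) \<Rightarrow> 'v set \<Rightarrow> grid_matrix \<Rightarrow> bool" where
  "drawable x y V M \<longleftrightarrow> (\<exists>X Y.
     (\<forall>u\<in>V. \<forall>v\<in>V. x u < x v \<longrightarrow> X u < X v) \<and>
     (\<forall>u\<in>V. \<forall>v\<in>V. y u < y v \<longrightarrow> Y u < Y v) \<and>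
     (\<forall>v\<in>V. (X v, Y v) \<in> standard_figure M))"

lemma drawable_transpose:
  assumes "drawable y x V (t, u, M)"
  shows "drawable x y V (u, t, \<lambda>k l. M l k)"
proof -
  have "(b, a) \<in> standard_figure (u, t, \<lambda>k l. M l k)"
    if "(a, b) \<in> standard_figure (t, u, M)" for a b
    using that cell_figure_swap unfolding standard_figure_def by fast
  then show ?thesis
    using assms unfolding drawable_def by blast
qed

text \<open>Listed by index, the drawn points run from left to right. Their heights are ordered like
  the values of \<open>\<pi>\<close>, which fill \<open>{1..n}\<close>, so the rank of each point
  from below is its value.\<close>

lemma drawable_imp_Geom:
  assumes perm: "is_perm \<pi>"
    and drawable: "drawable int (\<lambda>i. int (perm_at \<pi> i)) {1..length \<pi>} M"
  shows "\<pi> \<in> Geom M"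
proof -
  define n where "n = length \<pi>"
  obtain X Y where X: "\<And>i j. i \<in> {1..n} \<Longrightarrow> j \<in> {1..n} \<Longrightarrow> i < j \<Longrightarrow> X i < X j"
    and Y: "\<And>i j. i \<in> {1..n} \<Longrightarrow> j \<in> {1..n} \<Longrightarrow> perm_at \<pi> i < perm_at \<pi> j \<Longrightarrow> Y i < Y j"
    and fig: "\<And>i. i \<in> {1..n} \<Longrightarrow> (X i, Y i) \<in> standard_figure M"
    using drawable unfolding drawable_def n_def of_nat_less_iff by blast
  have \<pi>: "distinct \<pi>" "set \<pi> = {1..n}"
    using perm unfolding is_perm_def n_def permutations_of_set_def by auto
  have bij: "bij_betw (perm_at \<pi>) {1..n} {1..n}"
  proof -
    have "bij_betw ((!) \<pi>) {..<n} {1..n}"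
      using bij_betw_nth[OF \<pi>(1), of "{..<n}" "{1..n}"] \<pi>(2) n_def by simp
    moreover have "bij_betw (\<lambda>i. i - 1) {1..n} {..<n}"
      by (rule bij_betwI[where g = Suc]) auto
    ultimately show ?thesis
      using bij_betw_trans unfolding perm_at_def by (fastforce simp: comp_def)
  qed
  have Y_iff: "Y i \<le> Y j \<longleftrightarrow> perm_at \<pi> i \<le> perm_at \<pi> j" if "i \<in> {1..n}" "j \<in> {1..n}" for i j
    using that Y[of i j] Y[of j i] bij_betw_imp_inj_on[OF bij]
    by (metis inj_onD leD leI le_less order_refl)
  define ps where "ps = map (\<lambda>i. (X i, Y i)) [1..<Suc n]"
  have set_ps: "set ps = (\<lambda>i. (X i, Y i)) ` {1..n}"
    unfolding ps_def by auto
  have "card {q \<in> set ps. snd q \<le> Y i} = perm_at \<pi> i" if i: "i \<in> {1..n}" for i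
  proof -
    have "{q \<in> set ps. snd q \<le> Y i} = (\<lambda>j. (X j, Y j)) ` {j \<in> {1..n}. perm_at \<pi> j \<le> perm_at \<pi> i}"
      using Y_iff[OF _ i] unfolding set_ps by auto
    moreover have "inj_on (\<lambda>j. (X j, Y j)) {j \<in> {1..n}. perm_at \<pi> j \<le> perm_at \<pi> i}"
      by (rule inj_onI) (metis (no_types, lifting) X linorder_neqE_nat mem_Collect_eq prod.inject less_irrefl)
    ultimately have "card {q \<in> set ps. snd q \<le> Y i} = card {j \<in> {1..n}. perm_at \<pi> j \<le> perm_at \<pi> i}"
      by (simp add: card_image)
    also have "\<dots> = card (perm_at \<pi> ` {j \<in> {1..n}. perm_at \<pi> j \<le> perm_at \<pi> i})"
      by (rule card_image[symmetric], rule inj_on_subset[OF bij_betw_imp_inj_on[OF bij]]) auto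
    also have "perm_at \<pi> ` {j \<in> {1..n}. perm_at \<pi> j \<le> perm_at \<pi> i} = {1..perm_at \<pi> i}"
    proof -
      have "perm_at \<pi> i \<le> n" using bij i bij_betwE by fastforce
      moreover have "perm_at \<pi> ` {1..n} = {1..n}" using bij by (simp add: bij_betw_def)
      moreover have "perm_at \<pi> ` {j \<in> {1..n}. perm_at \<pi> j \<le> perm_at \<pi> i}
          = perm_at \<pi> ` {1..n} \<inter> {..perm_at \<pi> i}" by auto
      ultimately show ?thesis by auto
    qed
    finally show ?thesis by simp
  qed
  then have "perm_of_points ps = map (perm_at \<pi>) [1..<Suc n]"
    unfolding perm_of_points_def by (subst (2) ps_def) (auto simp del: upt_Suc)
  also have "\<dots> = \<pi>"
    unfolding perm_at_def n_def by (rule nth_equalityI) (auto simp del: upt_Suc)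
  finally have "perm_of_points ps = \<pi>" .
  moreover have "set ps \<subseteq> standard_figure M"
    using fig set_ps by auto
  moreover have "sorted_wrt (\<lambda>p q. fst p < fst q) ps"
    unfolding ps_def sorted_wrt_map
    by (rule sorted_wrt_mono_rel[OF _ sorted_wrt_upt]) (use X in auto)
  moreover have "distinct (map snd ps)"
  proof -
    have "inj_on Y {1..n}"
      using Y_iff bij_betw_imp_inj_on[OF bij]
      by (intro inj_onI) (metis inj_onD order_antisym order_refl)
    then show ?thesis
      unfolding ps_def by (simp add: distinct_map comp_def atLeastLessThanSuc_atLeastAtMost del: upt_Suc)
  qed
  ultimately show ?thesis
    unfolding Geom_def by blast
qed

section \<open>Drawings on two cells of equal slope\<close>

definition descent :: "'v set \<Rightarrow> ('v \<Rightarrow> int) \<Rightarrow> ('v \<Rightarrow> int) \<Rightarrow> 'v \<Rightarrow> 'v \<Rightarrow> bool" where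
  "descent V x y u v \<longleftrightarrow> u \<in> V \<and> v \<in> V \<and> x u < x v \<and> y v < y u"

text \<open>For finite \<open>V\<close>: some vertical line separates the two points of every descent.\<close>

definition descents_separated :: "'v set \<Rightarrow> ('v \<Rightarrow> int) \<Rightarrow> ('v \<Rightarrow> int) \<Rightarrow> bool" where
  "descents_separated V x y \<longleftrightarrow>
     (\<forall>u v u' v'. descent V x y u v \<longrightarrow> descent V x y u' v' \<longrightarrow> x u < x v')"

text \<open>The separating line splits the points into two columns, and inside each of them
  \<open>\<sigma> * y\<close> increases with \<open>x\<close>. Height alone can therefore fix the
  place of a point within its cell.\<close>

lemma drawable_two_columns:
  fixes \<sigma> :: int
  assumes \<sigma>: "\<sigma> \<in> {1, -1}" and inj: "inj_on y V"
    and sep: "descents_separated V x (\<lambda>v. \<sigma> * y v)"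
  shows "drawable x y V (2, 1, \<lambda>_ _. \<sigma>)"
proof -
  \<comment> \<open>By \<open>sep\<close> no descent ends in the left column, and every start of a
    descent lies in it.\<close>
  define left where
    "left v \<longleftrightarrow> (\<exists>u w. descent V x (\<lambda>v. \<sigma> * y v) u w \<and> x v \<le> x u)" for v
  define X where "X v = (if left v then 0 else 1) + squash (\<sigma> * y v)" for v
  define Y where "Y v = squash (y v)" for v
  have "X u < X v" if uv: "u \<in> V" "v \<in> V" "x u < x v" for u v
  proof (cases "left u = left v")
    case True
    have "\<not> descent V x (\<lambda>v. \<sigma> * y v) u v"
    proof
      assume uv: "descent V x (\<lambda>v. \<sigma> * y v) u v"
      then have "left v" using True unfolding left_def by blast
      then show False
        using uv sep unfolding left_def descents_separated_def by fastforce
    qed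
    then have "\<not> \<sigma> * y v < \<sigma> * y u"
      using uv unfolding descent_def by blast
    moreover have "\<sigma> * y u \<noteq> \<sigma> * y v"
      using uv inj \<sigma> by (auto dest: inj_onD)
    ultimately have "\<sigma> * y u < \<sigma> * y v" by linarith
    then have "real_of_int (\<sigma> * y u) < real_of_int (\<sigma> * y v)" by (simp only: of_int_less_iff)
    then show ?thesis
      unfolding X_def using True squash_strict_mono by simp
  next
    case False
    then have "left u" "\<not> left v"
      using uv unfolding left_def by (meson less_imp_le order_trans)+
    then show ?thesis
      unfolding X_def using squash_pos[of "\<sigma> * y v"] squash_less_1[of "\<sigma> * y u"] by simp
  qed
  moreover have "Y u < Y v" if "y u < y v" for u v
    unfolding Y_def using that squash_strict_mono by simp
  moreover have "(X v, Y v) \<in> standard_figure (2, 1, \<lambda>_ _. \<sigma>)" for v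
  proof -
    define k :: nat where "k = (if left v then 1 else 2)"
    have "X v = real k - 1 + squash (\<sigma> * y v)"
      unfolding X_def k_def by simp
    moreover have "(real k - 1 + squash (\<sigma> * y v), Y v) \<in> cell_figure \<sigma> k 1"
    proof (cases "\<sigma> = 1")
      case True
      then show ?thesis
        using increasing_cellI[OF squash_pos squash_less_1, of k "y v" 1] unfolding Y_def by simp
    next
      case False
      then have "\<sigma> = -1" using \<sigma> by simp
      then show ?thesis
        using decreasing_cellI[OF squash_pos squash_less_1, of k "- y v" 1]
        unfolding Y_def by (simp add: squash_minus)
    qed
    ultimately show ?thesis
      by (intro standard_figureI[where k = k and l = 1]) (auto simp: k_def)
  qed
  ultimately show ?thesis
    unfolding drawable_def by blast
qed

text \<open>The four open segments form the letter X around \<open>(1, 1)\<close>. The centre itself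
  is not on the figure, hence the positive distance \<open>s\<close> in
  \<open>X_matrix_arms\<close>.\<close>

definition X_matrix :: grid_matrix where
  "X_matrix = (2, 2, \<lambda>k l. if k = l then 1 else -1)"

lemma X_matrix_arms:
  assumes "0 < s" "s < 1"
  shows "(1 + s, 1 + s) \<in> standard_figure X_matrix" "(1 - s, 1 - s) \<in> standard_figure X_matrix"
    "(1 + s, 1 - s) \<in> standard_figure X_matrix" "(1 - s, 1 + s) \<in> standard_figure X_matrix"
proof -
  show "(1 + s, 1 + s) \<in> standard_figure X_matrix"
    unfolding X_matrix_def
    by (rule standard_figureI[where k = 2 and l = 2]) (use assms increasing_cellI[of s 2 2] in auto)
  show "(1 - s, 1 - s) \<in> standard_figure X_matrix"
    unfolding X_matrix_def
    by (rule standard_figureI[where k = 1 and l = 1]) (use assms increasing_cellI[of "1 - s" 1 1] in auto)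
  show "(1 + s, 1 - s) \<in> standard_figure X_matrix"
    unfolding X_matrix_def
    by (rule standard_figureI[where k = 2 and l = 1]) (use assms decreasing_cellI[of s 2 1] in auto)
  show "(1 - s, 1 + s) \<in> standard_figure X_matrix"
    unfolding X_matrix_def
    by (rule standard_figureI[where k = 1 and l = 2]) (use assms decreasing_cellI[of "1 - s" 1 2] in auto)
qed

section \<open>Chain structure between two homogeneous sets\<close>

text \<open>Adjacency in the permutation graph, for points with arbitrary integer
  coordinates.\<close>

definition inverted :: "('v \<Rightarrow> int) \<Rightarrow> ('v \<Rightarrow> int) \<Rightarrow> 'v \<Rightarrow> 'v \<Rightarrow> bool" where
  "inverted x y u v \<longleftrightarrow> x u < x v \<and> y v < y u \<or> x v < x u \<and> y u < y v"

lemma inverted_iff_mult: "inverted x y u v \<longleftrightarrow> (x u - x v) * (y u - y v) < 0"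
  unfolding inverted_def by (auto simp: mult_less_0_iff)

lemma inverted_sym: "inverted x y u v \<longleftrightarrow> inverted x y v u"
  unfolding inverted_def by auto

lemma inverted_uminus:
  assumes "inj_on x V" "inj_on y V" "u \<in> V" "v \<in> V" "u \<noteq> v"
  shows "inverted x (\<lambda>v. - y v) u v \<longleftrightarrow> \<not> inverted x y u v"
proof -
  have "x u \<noteq> x v" "y u \<noteq> y v" using assms by (auto dest: inj_onD)
  then show ?thesis unfolding inverted_def by auto
qed

text \<open>A 2-letter graph without its word: \<open>A\<close> and its complement stand for the two
  letters, \<open>p\<close> for suitably signed positions. Adjacency inside a side is left open, so
  that cliques and independent sets share the locale.\<close>

locale chain_partition =
  fixes V A :: "'v set" and x y p :: "'v \<Rightarrow> int"
  assumes inj_x: "inj_on x V" and inj_y: "inj_on y V" and inj_p: "inj_on p V"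
    and chain: "\<And>a b. \<lbrakk>a \<in> V; b \<in> V; a \<in> A; b \<notin> A\<rbrakk> \<Longrightarrow> inverted x y a b \<longleftrightarrow> p a < p b"
begin

lemma eq_coord:
  assumes "u \<in> V" "v \<in> V"
  shows "x u = x v \<longleftrightarrow> u = v" "y u = y v \<longleftrightarrow> u = v" "p u = p v \<longleftrightarrow> u = v"
  using assms inj_x inj_y inj_p by (auto dest: inj_onD)

lemma swap: "chain_partition V (- A) x y (\<lambda>v. - p v)"
proof
  show "inj_on (\<lambda>v. - p v) V" using inj_p by (simp add: inj_on_def)
  show "inverted x y a b \<longleftrightarrow> - p a < - p b" if "a \<in> V" "b \<in> V" "a \<in> - A" "b \<notin> - A" for a b
    using that chain[of b a] inverted_sym[of x y a b] by auto
qed (use inj_x inj_y in auto)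

text \<open>Turning the plot upside down complements the graph, which reverses the comparison of
  \<open>p\<close>; exchanging the two sides reverses it back.\<close>

lemma complement: "chain_partition V (- A) x (\<lambda>v. - y v) p"
proof
  show "inj_on (\<lambda>v. - y v) V" using inj_y by (simp add: inj_on_def)
  show "inverted x (\<lambda>v. - y v) a b \<longleftrightarrow> p a < p b"
    if ab: "a \<in> V" "b \<in> V" "a \<in> - A" "b \<notin> - A" for a b
  proof -
    have "a \<noteq> b" using ab by auto
    then have "p a \<noteq> p b" using ab eq_coord by simp
    then show ?thesis
      using ab \<open>a \<noteq> b\<close> chain[of b a] inverted_sym[of x y a b] inverted_uminus[OF inj_x inj_y ab(1,2)]
      by auto
  qed
qed (use inj_x inj_p in auto)

section \<open>Two independent sets, two cliques\<close>

text \<open>If both separations fail, the offending descents give \<open>p v2 < p u1\<close> and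
  \<open>p v3 < p u4\<close>. Auxiliary vertices \<open>a\<close> in \<open>A\<close> and
  \<open>b\<close> outside \<open>A\<close> then yield \<open>p u1 < p v3\<close> and
  \<open>p u4 < p v2\<close>, which closes a cycle.\<close>

lemma descents_separated_if_oriented:
  assumes indep_A: "\<And>u v. \<lbrakk>u \<in> V; v \<in> V; u \<in> A; v \<in> A\<rbrakk> \<Longrightarrow> \<not> inverted x y u v"
    and indep_B: "\<And>u v. \<lbrakk>u \<in> V; v \<in> V; u \<notin> A; v \<notin> A\<rbrakk> \<Longrightarrow> \<not> inverted x y u v"
    and oriented: "\<And>u v. descent V x y u v \<Longrightarrow> u \<in> A \<and> v \<notin> A"
  shows "descents_separated V x y \<or> descents_separated V y x"
proof (rule ccontr)
  assume neg: "\<not> (descents_separated V x y \<or> descents_separated V y x)"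
  obtain u1 v1 u2 v2 where D12: "descent V x y u1 v1" "descent V x y u2 v2" "\<not> x u1 < x v2"
    using neg unfolding descents_separated_def by blast
  obtain u3 v3 u4 v4 where D34: "descent V y x v3 u3" "descent V y x v4 u4" "\<not> y v3 < y u4"
    using neg unfolding descents_separated_def by blast
  then have D34': "descent V x y u3 v3" "descent V x y u4 v4"
    unfolding descent_def by auto
  note A = oriented[OF D12(1)] oriented[OF D12(2)] oriented[OF D34'(1)] oriented[OF D34'(2)]
  note inv = D12(1,2)[unfolded descent_def] D34'[unfolded descent_def]
  have "u1 \<noteq> v2" "u4 \<noteq> v3" using A by auto
  then have *: "x v2 < x u1" "y u4 < y v3"
    using D12(3) D34(3) inv eq_coord by (metis linorder_neqE)+
  have p_less: "p a < p b" if "a \<in> V" "b \<in> V" "a \<in> A" "b \<notin> A" "x a < x b" "y b < y a" for a b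
    using chain[OF that(1-4)] that(5,6) by (simp add: inverted_def)
  \<comment> \<open>Inversions that start outside \<open>A\<close> are excluded by
    \<open>oriented\<close>, so \<open>p a < p b\<close> determines the relative position of
    \<open>a\<close> and \<open>b\<close>.\<close>
  have inv_of_p: "x a < x b \<and> y b < y a" if "a \<in> V" "b \<in> V" "a \<in> A" "b \<notin> A" "p a < p b" for a b
    using chain[OF that(1-4)] that oriented[of b a] by (auto simp: inverted_def descent_def)
  have p_gt: "p b < p a" if "a \<in> V" "b \<in> V" "a \<in> A" "b \<notin> A" "x b < x a \<or> y a < y b" for a b
    using inv_of_p[OF that(1-4)] that eq_coord(3)[of a b] by (metis less_asym linorder_neqE)
  have p1: "p v2 < p u1" and p2: "p v3 < p u4"
    using p_gt * A inv by blast+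
  \<comment> \<open>The \<open>p\<close>-smaller of \<open>u2\<close> and \<open>u3\<close> precedes
    both \<open>v2\<close> and \<open>v3\<close>; dually, \<open>b\<close> is the
    \<open>p\<close>-larger of \<open>v1\<close> and \<open>v4\<close>.\<close>
  obtain a where a: "a \<in> V" "a \<in> A" "p a < p v2" "p a < p v3"
  proof (cases "p u2 < p u3")
    case True then show ?thesis using that[of u2] p_less A inv by (meson less_trans)
  next
    case False then show ?thesis using that[of u3] p_less[of u2 v2] p_less[of u3 v3] A inv by linarith
  qed
  obtain b where b: "b \<in> V" "b \<notin> A" "p u1 < p b" "p u4 < p b"
  proof (cases "p v1 < p v4")
    case True then show ?thesis using that[of v4] p_less A inv by (meson less_trans)
  next
    case False then show ?thesis using that[of v1] p_less[of u1 v1] p_less[of u4 v4] A inv by linarith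
  qed
  have 1: "x a < x v2" "y v3 < y a" "x u1 < x b" "y b < y u4"
    using inv_of_p a b A inv by blast+
  have mono_A: "x c < x d \<longleftrightarrow> y c < y d" if "c \<in> V" "d \<in> V" "c \<in> A" "d \<in> A" for c d
    using indep_A[OF that] eq_coord[OF that(1,2)] by (auto simp: inverted_def)
  have mono_B: "x c < x d \<longleftrightarrow> y c < y d" if "c \<in> V" "d \<in> V" "c \<notin> A" "d \<notin> A" for c d
    using indep_B[OF that] eq_coord[OF that(1,2)] by (auto simp: inverted_def)
  \<comment> \<open>Within an independent set both coordinates give the same order. Inequalities on
    one axis thus carry over to the other through \<open>a\<close> and \<open>b\<close>, and the
    pairs \<open>u4\<close>, \<open>v2\<close> and \<open>u1\<close>, \<open>v3\<close> turn out to
    be descents.\<close>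
  have "y v2 < y b" using mono_B[of v2 b] A inv b 1 * by linarith
  moreover have "x b < x v3" using mono_B[of b v3] A inv b 1 * by linarith
  moreover have "x u4 < x a" using mono_A[of u4 a] A inv a 1 * by linarith
  moreover have "y a < y u1" using mono_A[of a u1] A inv a 1 * by linarith
  ultimately have "p u4 < p v2" "p u1 < p v3"
    using p_less A inv 1 * by (meson less_trans)+
  then show False using p1 p2 by linarith
qed

text \<open>All descents are oriented alike, either from \<open>A\<close> to its complement or the
  other way round; \<open>swap\<close> reduces the second case to the first.\<close>

lemma descents_separated_or_transposed:
  assumes indep_A: "\<And>u v. \<lbrakk>u \<in> V; v \<in> V; u \<in> A; v \<in> A\<rbrakk> \<Longrightarrow> \<not> inverted x y u v"
    and indep_B: "\<And>u v. \<lbrakk>u \<in> V; v \<in> V; u \<notin> A; v \<notin> A\<rbrakk> \<Longrightarrow> \<not> inverted x y u v"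
  shows "descents_separated V x y \<or> descents_separated V y x"
proof -
  have mixed: "u \<in> A \<longleftrightarrow> v \<notin> A" if "u \<in> V" "v \<in> V" "x u < x v" "y v < y u" for u v
    using that indep_A[of u v] indep_B[of u v] by (auto simp: inverted_def)
  \<comment> \<open>A decreasing triple would be a triangle in a bipartite graph.\<close>
  have no_decr: "\<not> (x u < x v \<and> y v < y u \<and> x v < x w \<and> y w < y v)"
    if "u \<in> V" "v \<in> V" "w \<in> V" for u v w
    using that mixed[of u v] mixed[of v w] mixed[of u w] by auto
  have same: False
    if ab: "a \<in> V" "b \<in> V" "a \<in> A" "b \<notin> A" "x a < x b" "y b < y a"
      and ab': "a' \<in> V" "b' \<in> V" "a' \<in> A" "b' \<notin> A" "x b' < x a'" "y a' < y b'" for a b a' b'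
  proof -
    have "p a < p b" "p a' < p b'"
      using chain[of a b] chain[of a' b'] ab ab' by (auto simp: inverted_def)
    \<comment> \<open>Otherwise \<open>p a < p b \<le> p a' < p b' \<le> p a\<close>. The additional
      inversion extends one of the two given descents to a decreasing triple.\<close>
    then have "p a < p b' \<or> p a' < p b" by linarith
    then have "inverted x y a b' \<or> inverted x y a' b"
      using chain ab ab' by blast
    then show False
      using no_decr[of a b' a'] no_decr[of b' a b] no_decr[of b' a' b] no_decr[of a b a'] ab ab'
      by (auto simp: inverted_def)
  qed
  show ?thesis
  proof (cases "\<exists>a b. descent V x y a b \<and> a \<in> A")
    case True
    then obtain a b where ab: "descent V x y a b" "a \<in> A" by blast
    have "u \<in> A \<and> v \<notin> A" if uv: "descent V x y u v" for u v
      using same[of a b v u] ab uv mixed[of a b] mixed[of u v] unfolding descent_def by blast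
    then show ?thesis
      using descents_separated_if_oriented[OF indep_A indep_B] by blast
  next
    case False
    show ?thesis
    proof (rule chain_partition.descents_separated_if_oriented[OF swap])
      show "u \<in> - A \<and> v \<notin> - A" if "descent V x y u v" for u v
        using that False mixed[of u v] unfolding descent_def by blast
    qed (use indep_A indep_B in auto)
  qed
qed

lemma drawable_independent:
  assumes "\<And>u v. \<lbrakk>u \<in> V; v \<in> V; u \<in> A; v \<in> A\<rbrakk> \<Longrightarrow> \<not> inverted x y u v"
    and "\<And>u v. \<lbrakk>u \<in> V; v \<in> V; u \<notin> A; v \<notin> A\<rbrakk> \<Longrightarrow> \<not> inverted x y u v"
  shows "drawable x y V (2, 1, \<lambda>_ _. 1) \<or> drawable x y V (1, 2, \<lambda>_ _. 1)"
  using descents_separated_or_transposed[OF assms]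
proof
  assume "descents_separated V x y"
  then have "drawable x y V (2, 1, \<lambda>_ _. 1)"
    by (intro drawable_two_columns inj_y) simp_all
  then show ?thesis ..
next
  assume "descents_separated V y x"
  then have "drawable y x V (2, 1, \<lambda>_ _. 1)"
    by (intro drawable_two_columns inj_x) simp_all
  then show ?thesis by (rule disjI2[OF drawable_transpose])
qed

text \<open>Reflecting the plot turns cliques into independent sets, and separation of the reflected
  descents is what \<open>drawable_two_columns\<close> asks for with sign -1.\<close>

lemma drawable_cliques:
  assumes "\<And>u v. \<lbrakk>u \<in> V; v \<in> V; u \<noteq> v; u \<in> A; v \<in> A\<rbrakk> \<Longrightarrow> inverted x y u v"
    and "\<And>u v. \<lbrakk>u \<in> V; v \<in> V; u \<noteq> v; u \<notin> A; v \<notin> A\<rbrakk> \<Longrightarrow> inverted x y u v"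
  shows "drawable x y V (2, 1, \<lambda>_ _. -1) \<or> drawable x y V (1, 2, \<lambda>_ _. -1)"
proof -
  have irrefl: "\<not> inverted x (\<lambda>v. - y v) u u" for u by (simp add: inverted_def)
  have "\<not> inverted x (\<lambda>v. - y v) u v" if "u \<in> V" "v \<in> V" "u \<in> - A" "v \<in> - A" for u v
    using that assms(2)[of u v] irrefl inverted_uminus[OF inj_x inj_y, of u v] by (cases "u = v") auto
  moreover have "\<not> inverted x (\<lambda>v. - y v) u v" if "u \<in> V" "v \<in> V" "u \<notin> - A" "v \<notin> - A" for u v
    using that assms(1)[of u v] irrefl inverted_uminus[OF inj_x inj_y, of u v] by (cases "u = v") auto
  ultimately have "descents_separated V x (\<lambda>v. - y v) \<or> descents_separated V (\<lambda>v. - y v) x"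
    using chain_partition.descents_separated_or_transposed[OF complement] by blast
  \<comment> \<open>For the transposed drawing the minus sign has to sit on \<open>x\<close>, which
    becomes the height. The descents are the same pairs with their ends exchanged.\<close>
  moreover have "descents_separated V y (\<lambda>v. - x v)" if "descents_separated V (\<lambda>v. - y v) x"
  proof -
    have "descent V y (\<lambda>v. - x v) u v \<longleftrightarrow> descent V (\<lambda>v. - y v) x v u" for u v
      unfolding descent_def by auto
    then show ?thesis
      using that unfolding descents_separated_def by auto
  qed
  ultimately consider "descents_separated V x (\<lambda>v. - y v)" | "descents_separated V y (\<lambda>v. - x v)"
    by blast
  then show ?thesis
  proof cases
    case 1
    then have "drawable x y V (2, 1, \<lambda>_ _. -1)"
      by (intro drawable_two_columns inj_y) simp_all
    then show ?thesis ..
  next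
    case 2
    then have "drawable y x V (2, 1, \<lambda>_ _. -1)"
      by (intro drawable_two_columns inj_x) simp_all
    then show ?thesis by (rule disjI2[OF drawable_transpose])
  qed
qed

section \<open>An independent set and a clique: the figure X\<close>

text \<open>
  The map \<open>T\<close> orders the vertices by the block of \<open>p\<close> they lie in (a maximal set of consecutive
  vertices on the same side of the partition), and inside a block by \<open>d\<close>.
\<close>

lemma block_order:
  fixes d :: "'v \<Rightarrow> int"
  assumes fin: "finite V"
  obtains T :: "'v \<Rightarrow> real" where "\<And>v. 0 < T v" "\<And>v. T v < 1"
    and "\<And>u v. \<lbrakk>u \<in> V; v \<in> V; u \<in> A \<longleftrightarrow> v \<notin> A; p u < p v\<rbrakk> \<Longrightarrow> T u < T v"
    and "\<And>u v. \<lbrakk>u \<in> V; v \<in> V; u \<in> A \<longleftrightarrow> v \<in> A; d u < d v;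
      \<And>g. \<lbrakk>g \<in> V; g \<in> A \<longleftrightarrow> u \<notin> A; p v < p g; p g < p u\<rbrakk> \<Longrightarrow> False\<rbrakk> \<Longrightarrow> T u < T v"
proof -
  \<comment> \<open>Everything up to the last vertex that precedes \<open>v\<close> and lies on the
    other side. This set is constant on a block and grows strictly towards later vertices of the
    other side.\<close>
  define before where
    "before v = {g \<in> V. \<exists>h\<in>V. (h \<in> A \<longleftrightarrow> v \<notin> A) \<and> p g \<le> p h \<and> p h < p v}" for v
  define L where "L v = card (before v)" for v
  have fin': "finite (before v)" for v
    using fin unfolding before_def by simp
  \<comment> \<open>The integer \<open>L v\<close> selects the block; the inner
    \<open>squash\<close> stays below 1, so \<open>d\<close> only orders vertices with equal
    \<open>L\<close>. The outer one brings the result into the unit interval.\<close>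
  define T where "T v = squash (real (L v) + squash (d v))" for v
  have less: "T u < T v" if "L u < L v" for u v
  proof -
    have "real (L u) + 1 \<le> real (L v)" using that by linarith
    then have "real (L u) + squash (d u) < real (L v) + squash (d v)"
      using squash_less_1[of "d u"] squash_pos[of "d v"] by linarith
    then show ?thesis unfolding T_def by (rule squash_strict_mono)
  qed
  show ?thesis
  proof
    show "0 < T v" "T v < 1" for v
      unfolding T_def by (simp_all add: squash_pos squash_less_1)
  next
    fix u v assume uv: "u \<in> V" "v \<in> V" "u \<in> A \<longleftrightarrow> v \<notin> A" "p u < p v"
    have "u \<in> before v" "u \<notin> before u" "before u \<subseteq> before v"
      using uv unfolding before_def by fastforce+
    then have "before u \<subset> before v" by blast
    then show "T u < T v"
      using less fin' unfolding L_def by (simp add: psubset_card_mono)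
  next
    fix u v assume uv: "u \<in> V" "v \<in> V" "u \<in> A \<longleftrightarrow> v \<in> A" "d u < d v"
      and none: "\<And>g. \<lbrakk>g \<in> V; g \<in> A \<longleftrightarrow> u \<notin> A; p v < p g; p g < p u\<rbrakk> \<Longrightarrow> False"
    have "p h < p v" if "h \<in> V" "h \<in> A \<longleftrightarrow> u \<notin> A" "p h < p u" for h
      using none[OF that(1,2)] that uv eq_coord(3)[of h v] by (metis linorder_neqE)
    then have "before u \<subseteq> before v"
      using uv(3) unfolding before_def by blast
    then have "L u \<le> L v"
      using fin' unfolding L_def by (simp add: card_mono)
    moreover have "squash (d u) < squash (d v)"
      using uv(4) squash_strict_mono by simp
    ultimately show "T u < T v"
      unfolding T_def by (intro squash_strict_mono) linarith
  qed
qed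

text \<open>\<open>R\<close> and \<open>U\<close> tell which vertices lie right of and above the
  centre; \<open>A\<close> occupies the increasing arms. Distances from the centre are compared by
  \<open>p\<close> between arms of different slope and by the coordinates along one arm.
  \<open>block_order\<close> merges these comparisons into one distance \<open>T\<close>.\<close>

lemma drawable_X_centred:
  fixes R U :: "'v \<Rightarrow> bool"
  assumes fin: "finite V"
    and indep: "\<And>u v. \<lbrakk>u \<in> V; v \<in> V; u \<in> A; v \<in> A\<rbrakk> \<Longrightarrow> \<not> inverted x y u v"
    and clique: "\<And>u v. \<lbrakk>u \<in> V; v \<in> V; u \<noteq> v; u \<notin> A; v \<notin> A\<rbrakk> \<Longrightarrow> inverted x y u v"
    and R: "\<And>u v. \<lbrakk>u \<in> V; v \<in> V; x u < x v; R u\<rbrakk> \<Longrightarrow> R v"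
    and U: "\<And>u v. \<lbrakk>u \<in> V; v \<in> V; y u < y v; U u\<rbrakk> \<Longrightarrow> U v"
    and RU: "\<And>v. v \<in> V \<Longrightarrow> v \<in> A \<longleftrightarrow> (R v \<longleftrightarrow> U v)"
  shows "drawable x y V X_matrix"
proof -
  \<comment> \<open>Distance from the centre up to an additive constant, hence compared only between
    vertices in the same half plane.\<close>
  define dist where "dist c S v = (if S v then c v else - c v)" for c :: "'v \<Rightarrow> int" and S v
  obtain T :: "'v \<Rightarrow> real" where T01: "\<And>v. 0 < T v" "\<And>v. T v < 1"
    and T_opp: "\<And>u v. \<lbrakk>u \<in> V; v \<in> V; u \<in> A \<longleftrightarrow> v \<notin> A; p u < p v\<rbrakk> \<Longrightarrow> T u < T v"
    and T_same: "\<And>u v. \<lbrakk>u \<in> V; v \<in> V; u \<in> A \<longleftrightarrow> v \<in> A; dist x R u < dist x R v;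
      \<And>g. \<lbrakk>g \<in> V; g \<in> A \<longleftrightarrow> u \<notin> A; p v < p g; p g < p u\<rbrakk> \<Longrightarrow> False\<rbrakk> \<Longrightarrow> T u < T v"
    using block_order[OF fin, of "dist x R"] by blast
  \<comment> \<open>Vertices of opposite sides in one half plane lie in different quadrants. Their
    vertical order is thus known, and adjacency decides the horizontal one.\<close>
  have opp_x: "p u < p v \<longleftrightarrow> dist x R u < dist x R v"
    if uv: "u \<in> V" "v \<in> V" "u \<in> A \<longleftrightarrow> v \<notin> A" "R u = R v" for u v
  proof -
    have *: "p a < p b \<longleftrightarrow> dist x R a < dist x R b" "p b < p a \<longleftrightarrow> dist x R b < dist x R a"
      if "a \<in> V" "b \<in> V" "a \<in> A" "b \<notin> A" "R a = R b" for a b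
    proof -
      have "a \<noteq> b" using that by auto
      then have ne: "x a \<noteq> x b" "y a \<noteq> y b" "p a \<noteq> p b" using that eq_coord by auto
      have "R a \<longleftrightarrow> U a" "R b \<longleftrightarrow> \<not> U b" using RU that by auto
      then have "R b \<longleftrightarrow> y b < y a"
        using U[OF that(1,2)] U[OF that(2,1)] that(5) ne by (meson linorder_neqE less_asym)
      then have "p a < p b \<longleftrightarrow> (if R b then x a < x b else x b < x a)"
        using chain[OF that(1-4)] ne unfolding inverted_def by auto
      then show "p a < p b \<longleftrightarrow> dist x R a < dist x R b" "p b < p a \<longleftrightarrow> dist x R b < dist x R a"
        using that(5) ne unfolding dist_def by (auto split: if_splits)
    qed
    show ?thesis using *[of u v] *[of v u] uv by blast
  qed
  have opp_y: "p u < p v \<longleftrightarrow> dist y U u < dist y U v"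
    if uv: "u \<in> V" "v \<in> V" "u \<in> A \<longleftrightarrow> v \<notin> A" "U u = U v" for u v
  proof -
    have *: "p a < p b \<longleftrightarrow> dist y U a < dist y U b" "p b < p a \<longleftrightarrow> dist y U b < dist y U a"
      if "a \<in> V" "b \<in> V" "a \<in> A" "b \<notin> A" "U a = U b" for a b
    proof -
      have "a \<noteq> b" using that by auto
      then have ne: "x a \<noteq> x b" "y a \<noteq> y b" "p a \<noteq> p b" using that eq_coord by auto
      have "R a \<longleftrightarrow> U a" "R b \<longleftrightarrow> \<not> U b" using RU that by auto
      then have "U b \<longleftrightarrow> x b < x a"
        using R[OF that(1,2)] R[OF that(2,1)] that(5) ne by (meson linorder_neqE less_asym)
      then have "p a < p b \<longleftrightarrow> (if U b then y a < y b else y b < y a)"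
        using chain[OF that(1-4)] ne unfolding inverted_def by auto
      then show "p a < p b \<longleftrightarrow> dist y U a < dist y U b" "p b < p a \<longleftrightarrow> dist y U b < dist y U a"
        using that(5) ne unfolding dist_def by (auto split: if_splits)
    qed
    show ?thesis using *[of u v] *[of v u] uv by blast
  qed
  have same_xy: "dist x R u < dist x R v \<longleftrightarrow> dist y U u < dist y U v"
    if uv: "u \<in> V" "v \<in> V" "u \<in> A \<longleftrightarrow> v \<in> A" "R u = R v" for u v
  proof (cases "u = v")
    case False
    then have ne: "x u \<noteq> x v" "y u \<noteq> y v" using uv eq_coord by auto
    show ?thesis
    proof (cases "u \<in> A")
      case True
      then have "R u \<longleftrightarrow> U u" "R v \<longleftrightarrow> U v" using RU uv by auto
      then show ?thesis
        using indep[of u v] True uv ne unfolding inverted_def dist_def by auto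
    next
      case nA: False
      then have "R u \<longleftrightarrow> \<not> U u" "R v \<longleftrightarrow> \<not> U v" using RU uv by auto
      then show ?thesis
        using clique[of u v] nA False uv ne unfolding inverted_def dist_def by auto
    qed
  qed simp
  have same: "T u < T v"
    if uv: "u \<in> V" "v \<in> V" "u \<in> A \<longleftrightarrow> v \<in> A" "R u = R v" "dist x R u < dist x R v" for u v
  proof (rule T_same)
    \<comment> \<open>The quadrant of \<open>g\<close> shares a half plane with that of
      \<open>u\<close> and \<open>v\<close>. There \<open>p\<close> agrees with the distance, so
      \<open>g\<close> would be farther out than \<open>v\<close> and nearer than \<open>u\<close>,
      although \<open>u\<close> is nearer than \<open>v\<close>.\<close>
    fix g assume g: "g \<in> V" "g \<in> A \<longleftrightarrow> u \<notin> A" "p v < p g" "p g < p u"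
    have "U u = U v" using RU uv by blast
    moreover have "R g = R u \<or> U g = U u" using RU[of g] RU[of u] g uv by blast
    moreover have "dist y U u < dist y U v" using same_xy uv by blast
    ultimately show False
      using opp_x[of v g] opp_x[of g u] opp_y[of v g] opp_y[of g u] uv g
      by (metis less_asym less_trans)
  qed (use uv in auto)
  have T_x: "T u < T v" if "u \<in> V" "v \<in> V" "R u = R v" "dist x R u < dist x R v" for u v
    using that same[of u v] T_opp[of u v] opp_x[of u v] by blast
  have T_y: "T u < T v" if "u \<in> V" "v \<in> V" "U u = U v" "dist y U u < dist y U v" for u v
    using that same[of u v] same_xy[of u v] T_opp[of u v] opp_y[of u v] RU[of u] RU[of v] by blast
  define pos where "pos S v = (if S v then 1 + T v else 1 - T v)" for S v
  have pos_mono: "pos S u < pos S v"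
    if "c u < c v" "S u \<Longrightarrow> S v" "S u = S v \<Longrightarrow> dist c S u < dist c S v \<Longrightarrow> T u < T v"
      "S u = S v \<Longrightarrow> dist c S v < dist c S u \<Longrightarrow> T v < T u" for S u v and c :: "'v \<Rightarrow> int"
    using that T01[of u] T01[of v] unfolding pos_def dist_def by (auto split: if_splits)
  show ?thesis
    unfolding drawable_def
  proof (intro exI conjI ballI impI)
    fix u v assume "u \<in> V" "v \<in> V" "x u < x v"
    then show "pos R u < pos R v"
      using R T_x by (intro pos_mono[of x]) auto
  next
    fix u v assume "u \<in> V" "v \<in> V" "y u < y v"
    then show "pos U u < pos U v"
      using U T_y by (intro pos_mono[of y]) auto
  next
    fix v
    show "(pos R v, pos U v) \<in> standard_figure X_matrix"
      using X_matrix_arms[OF T01] unfolding pos_def by simp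
  qed
qed

text \<open>The \<open>p\<close>-least vertex \<open>c\<close> can serve as centre: on whichever
  side it lies, it is adjacent to every other vertex outside \<open>A\<close> and to none in
  \<open>A\<close>, which assigns the quadrants.\<close>

lemma drawable_X:
  assumes fin: "finite V"
    and indep: "\<And>u v. \<lbrakk>u \<in> V; v \<in> V; u \<in> A; v \<in> A\<rbrakk> \<Longrightarrow> \<not> inverted x y u v"
    and clique: "\<And>u v. \<lbrakk>u \<in> V; v \<in> V; u \<noteq> v; u \<notin> A; v \<notin> A\<rbrakk> \<Longrightarrow> inverted x y u v"
  shows "drawable x y V X_matrix"
proof (cases "V = {}")
  case True
  then show ?thesis by (simp add: drawable_def)
next
  case False
  then obtain c where c: "c \<in> V" "\<And>v. v \<in> V \<Longrightarrow> p c \<le> p v"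
    using fin by (metis arg_min_least arg_min_if_finite(1))
  then have p_less: "p c < p v" if "v \<in> V" "v \<noteq> c" for v
    using that eq_coord(3)[of c v] by (metis le_neq_trans)
  show ?thesis
  proof (cases "c \<in> A")
    case True
    \<comment> \<open>With two strict comparisons \<open>c\<close> itself falls into the lower left
      quadrant, on an increasing arm.\<close>
    have "v \<in> A \<longleftrightarrow> (x c < x v \<longleftrightarrow> y c < y v)" if v: "v \<in> V" for v
    proof (cases "v = c")
      case False
      then have "x c \<noteq> x v" "y c \<noteq> y v" using c v eq_coord by auto
      then show ?thesis
        using indep[of c v] chain[of c v] p_less[of v] True False c v unfolding inverted_def by (cases "v \<in> A") auto
    qed (use True in auto)
    then show ?thesis
      by (intro drawable_X_centred[where R = "\<lambda>v. x c < x v" and U = "\<lambda>v. y c < y v"])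
        (use assms in auto)
  next
    case nA: False
    \<comment> \<open>The non-strict comparison of heights puts \<open>c\<close> into the upper left
      quadrant, on a decreasing arm.\<close>
    have "v \<in> A \<longleftrightarrow> (x c < x v \<longleftrightarrow> y c \<le> y v)" if v: "v \<in> V" for v
    proof (cases "v = c")
      case False
      then have "x c \<noteq> x v" "y c \<noteq> y v" using c v eq_coord by auto
      then show ?thesis
        using clique[of c v] chain[of v c] p_less[of v] nA False c v unfolding inverted_def by (cases "v \<in> A") auto
    qed (use nA in auto)
    then show ?thesis
      by (intro drawable_X_centred[where R = "\<lambda>v. x c < x v" and U = "\<lambda>v. y c \<le> y v"])
        (use assms in auto)
  qed
qed

end

section \<open>Permutations with a 2-letter graph\<close>

lemma letter_graph_edge:
  assumes "i \<in> {1..length w}" "j \<in> {1..length w}" "i < j"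
  shows "{i, j} \<in> snd (letter_graph P w) \<longleftrightarrow> (w ! (i - 1), w ! (j - 1)) \<in> P"
proof
  assume "{i, j} \<in> snd (letter_graph P w)"
  then show "(w ! (i - 1), w ! (j - 1)) \<in> P"
    using assms unfolding letter_graph_def by (auto simp: doubleton_eq_iff)
next
  assume "(w ! (i - 1), w ! (j - 1)) \<in> P"
  then show "{i, j} \<in> snd (letter_graph P w)"
    using assms unfolding letter_graph_def snd_conv by blast
qed

lemma perm_graph_edge:
  assumes "i \<in> {1..length \<pi>}" "j \<in> {1..length \<pi>}"
  shows "{i, j} \<in> snd (perm_graph \<pi>) \<longleftrightarrow> inverted int (\<lambda>i. int (perm_at \<pi> i)) i j"
proof -
  have "{i, j} \<in> snd (perm_graph \<pi>) \<longleftrightarrow>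
      inverted int (\<lambda>i. int (perm_at \<pi> i)) i j \<or> inverted int (\<lambda>i. int (perm_at \<pi> i)) j i"
    using assms unfolding perm_graph_def inverted_iff_mult by (auto simp: doubleton_eq_iff)
  then show ?thesis by (simp add: inverted_sym[of _ _ j i])
qed

text \<open>Vertices with equal letters are all adjacent or all non-adjacent, as the decoder has one
  entry for them. For different letters, each of the four possible decoders becomes a comparison of
  positions after suitable changes of sign.\<close>

lemma two_letter_graph_partition:
  fixes G :: "'v graph"
  assumes "is_letter_graph 2 G"
  shows "\<exists>A \<alpha> \<beta>. \<exists>p :: 'v \<Rightarrow> int. inj_on p (fst G) \<and> (\<forall>u\<in>fst G. \<forall>v\<in>fst G. u \<noteq> v \<longrightarrow>
    (u \<in> A \<and> v \<in> A \<longrightarrow> ({u, v} \<in> snd G \<longleftrightarrow> \<alpha>)) \<and>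
    (u \<notin> A \<and> v \<notin> A \<longrightarrow> ({u, v} \<in> snd G \<longleftrightarrow> \<beta>)) \<and>
    (u \<in> A \<and> v \<notin> A \<longrightarrow> ({u, v} \<in> snd G \<longleftrightarrow> p u < p v)))"
proof -
  obtain \<Sigma> :: "nat set" and P w where \<Sigma>: "finite \<Sigma>" "card \<Sigma> \<le> 2" "set w \<subseteq> \<Sigma>"
    and iso: "graph_isomorphic G (letter_graph P w)"
    using assms unfolding is_letter_graph_def by blast
  define n where "n = length w"
  obtain f where f: "bij_betw f (fst G) {1..n}"
    and edge: "\<And>u v. u \<in> fst G \<Longrightarrow> v \<in> fst G \<Longrightarrow> {u, v} \<in> snd G \<longleftrightarrow> {f u, f v} \<in> snd (letter_graph P w)"
    using iso unfolding graph_isomorphic_def n_def letter_graph_def by auto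
  \<comment> \<open>A smaller alphabet is covered too: \<open>a = b\<close> is allowed and puts
    every vertex into \<open>A\<close>.\<close>
  obtain a b where ab: "\<Sigma> \<subseteq> {a, b}"
  proof -
    have "card \<Sigma> = 0 \<or> card \<Sigma> = 1 \<or> card \<Sigma> = 2" using \<Sigma>(2) by linarith
    then show ?thesis using that \<Sigma>(1) by (auto simp: card_1_singleton_iff card_2_iff)
  qed
  define A where "A = {v. w ! (f v - 1) = a}"
  have f_range: "f v \<in> {1..n}" if "v \<in> fst G" for v using that f bij_betwE by blast
  have f_inj: "inj_on f (fst G)" using f by (rule bij_betw_imp_inj_on)
  have letter_b: "w ! (f v - 1) = b" if "v \<in> fst G" "v \<notin> A" for v
  proof -
    have "w ! (f v - 1) \<in> set w" using f_range[OF that(1)] unfolding n_def by (intro nth_mem) auto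
    then show ?thesis using that \<Sigma>(3) ab unfolding A_def by auto
  qed
  have letter_a: "w ! (f v - 1) = a" if "v \<in> A" for v
    using that unfolding A_def by simp
  have adj: "{u, v} \<in> snd G \<longleftrightarrow>
      (if f u < f v then (w ! (f u - 1), w ! (f v - 1)) \<in> P else (w ! (f v - 1), w ! (f u - 1)) \<in> P)"
    if uv: "u \<in> fst G" "v \<in> fst G" "u \<noteq> v" for u v
  proof -
    have "f u \<noteq> f v" using uv f_inj by (auto dest: inj_onD)
    then show ?thesis
      using edge[OF uv(1,2)] letter_graph_edge[of "f u" w "f v" P] letter_graph_edge[of "f v" w "f u" P]
        f_range[OF uv(1)] f_range[OF uv(2)] unfolding n_def by (auto simp: insert_commute)
  qed
  \<comment> \<open>If both mixed pairs are decoded as edges, \<open>A\<close> goes before all else;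
    if neither is, after all else; if just one is, the word order or its reverse is taken. Positions
    start at 1, so opposite signs never collide and \<open>p\<close> is injective.\<close>
  define p :: "'v \<Rightarrow> int" where
    "p v = (if (a, b) \<in> P \<and> (b, a) \<in> P then (if v \<in> A then - int (f v) else int (f v))
            else if (a, b) \<in> P then int (f v)
            else if (b, a) \<in> P then - int (f v)
            else (if v \<in> A then int (f v) else - int (f v)))" for v
  have "inj_on p (fst G)"
  proof (rule inj_onI)
    fix u v assume uv: "u \<in> fst G" "v \<in> fst G" and eq: "p u = p v"
    have "f u = f v"
      using eq f_range[OF uv(1)] f_range[OF uv(2)] unfolding p_def by (auto split: if_splits)
    then show "u = v" using uv f_inj by (auto dest: inj_onD)
  qed
  moreover have "{u, v} \<in> snd G \<longleftrightarrow> p u < p v"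
    if uv: "u \<in> fst G" "v \<in> fst G" "u \<in> A" "v \<notin> A" for u v
  proof -
    have ne: "u \<noteq> v" using uv by auto
    then have "f u \<noteq> f v" using uv f_inj by (auto dest: inj_onD)
    then show ?thesis
      using adj[OF uv(1,2) ne] letter_a[OF uv(3)] letter_b[OF uv(2,4)] uv f_range[OF uv(1)] f_range[OF uv(2)]
      unfolding p_def by auto
  qed
  moreover have "{u, v} \<in> snd G \<longleftrightarrow> (a, a) \<in> P"
    if "u \<in> fst G" "v \<in> fst G" "u \<noteq> v" "u \<in> A" "v \<in> A" for u v
    using adj[OF that(1-3)] letter_a[OF that(4)] letter_a[OF that(5)] by simp
  moreover have "{u, v} \<in> snd G \<longleftrightarrow> (b, b) \<in> P"
    if "u \<in> fst G" "v \<in> fst G" "u \<noteq> v" "u \<notin> A" "v \<notin> A" for u v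
    using adj[OF that(1-3)] letter_b[OF that(1,4)] letter_b[OF that(2,5)] by simp
  ultimately show ?thesis
    by (intro exI[of _ A] exI[of _ "(a, a) \<in> P"] exI[of _ "(b, b) \<in> P"] exI[of _ p] conjI ballI impI)
      simp_all
qed

lemma Geom_if_two_letter_graph:
  assumes perm: "is_perm \<pi>" and "is_letter_graph 2 (perm_graph \<pi>)"
  shows "\<exists>M \<in> {X_matrix, (2, 1, \<lambda>_ _. 1), (1, 2, \<lambda>_ _. 1), (2, 1, \<lambda>_ _. -1), (1, 2, \<lambda>_ _. -1)}.
    \<pi> \<in> Geom M"
proof -
  define V where "V = {1..length \<pi>}"
  define y where "y i = int (perm_at \<pi> i)" for i
  have fst: "fst (perm_graph \<pi>) = V" by (simp add: perm_graph_def V_def)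
  have edge: "{u, v} \<in> snd (perm_graph \<pi>) \<longleftrightarrow> inverted int y u v" if "u \<in> V" "v \<in> V" for u v
    using that perm_graph_edge unfolding V_def y_def by blast
  obtain A \<alpha> \<beta> and p :: "nat \<Rightarrow> int" where p: "inj_on p V"
    and *: "\<forall>u\<in>V. \<forall>v\<in>V. u \<noteq> v \<longrightarrow>
      (u \<in> A \<and> v \<in> A \<longrightarrow> ({u, v} \<in> snd (perm_graph \<pi>) \<longleftrightarrow> \<alpha>)) \<and>
      (u \<notin> A \<and> v \<notin> A \<longrightarrow> ({u, v} \<in> snd (perm_graph \<pi>) \<longleftrightarrow> \<beta>)) \<and>
      (u \<in> A \<and> v \<notin> A \<longrightarrow> ({u, v} \<in> snd (perm_graph \<pi>) \<longleftrightarrow> p u < p v))"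
    using two_letter_graph_partition[OF assms(2)] unfolding fst by (elim exE conjE)
  have \<alpha>: "\<And>u v. \<lbrakk>u \<in> V; v \<in> V; u \<noteq> v; u \<in> A; v \<in> A\<rbrakk> \<Longrightarrow> inverted int y u v \<longleftrightarrow> \<alpha>"
    and \<beta>: "\<And>u v. \<lbrakk>u \<in> V; v \<in> V; u \<noteq> v; u \<notin> A; v \<notin> A\<rbrakk> \<Longrightarrow> inverted int y u v \<longleftrightarrow> \<beta>"
    and chain: "\<And>u v. \<lbrakk>u \<in> V; v \<in> V; u \<in> A; v \<notin> A\<rbrakk> \<Longrightarrow> inverted int y u v \<longleftrightarrow> p u < p v"
    using * edge by (force, force, metis)
  have inj_y: "inj_on y V"
  proof (rule inj_onI)
    fix i j assume "i \<in> V" "j \<in> V" "y i = y j"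
    then have "\<pi> ! (i - 1) = \<pi> ! (j - 1)" "i - 1 < length \<pi>" "j - 1 < length \<pi>" "1 \<le> i" "1 \<le> j"
      unfolding V_def y_def perm_at_def by auto
    moreover have "distinct \<pi>"
      using perm unfolding is_perm_def permutations_of_set_def by simp
    ultimately show "i = j" using nth_eq_iff_index_eq by fastforce
  qed
  interpret chain_partition V A int y p
    using inj_y p chain by unfold_locales auto
  have fin: "finite V" unfolding V_def by simp
  have irrefl: "\<not> inverted int y u u" for u by (simp add: inverted_def)
  have "\<exists>M \<in> {X_matrix, (2, 1, \<lambda>_ _. 1), (1, 2, \<lambda>_ _. 1), (2, 1, \<lambda>_ _. -1), (1, 2, \<lambda>_ _. -1)}.
    drawable int y V M"
  proof (cases \<alpha>; cases \<beta>)
    assume "\<alpha>" "\<beta>"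
    then show ?thesis using drawable_cliques \<alpha> \<beta> by blast
  next
    assume "\<not> \<alpha>" "\<not> \<beta>"
    then have "drawable int y V (2, 1, \<lambda>_ _. 1) \<or> drawable int y V (1, 2, \<lambda>_ _. 1)"
      by (intro drawable_independent) (use \<alpha> \<beta> irrefl in metis)+
    then show ?thesis by blast
  next
    assume "\<not> \<alpha>" "\<beta>"
    then have "drawable int y V X_matrix"
      by (intro drawable_X fin) (use \<alpha> \<beta> irrefl in metis)+
    then show ?thesis by blast
  next
    \<comment> \<open>Here the clique is \<open>A\<close>, so the two sides are exchanged
      first.\<close>
    assume "\<alpha>" "\<not> \<beta>"
    then have "drawable int y V X_matrix"
      by (intro chain_partition.drawable_X[OF swap] fin) (use \<alpha> \<beta> irrefl in \<open>metis Compl_iff\<close>)+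
    then show ?thesis by blast
  qed
  then show ?thesis
    using drawable_imp_Geom[OF perm] unfolding V_def y_def by blast
qed

theorem theorem4:
  fixes X :: "nat list set"
  assumes "perm_class X"
    and "\<forall>G\<in>perm_graphs X. is_letter_graph 2 G"
  shows "geometrically_griddable X"
proof -
  \<comment> \<open>These five matrices serve permutations of every length.\<close>
  let ?\<M> = "{X_matrix, (2, 1, \<lambda>_ _. 1), (1, 2, \<lambda>_ _. 1), (2, 1, \<lambda>_ _. -1), (1, 2, \<lambda>_ _. -1)}"
  have "\<exists>M \<in> ?\<M>. \<pi> \<in> Geom M" if "\<pi> \<in> X" for \<pi>
  proof (rule Geom_if_two_letter_graph)
    show "is_perm \<pi>" using that assms(1) unfolding perm_class_def by blast
    show "is_letter_graph 2 (perm_graph \<pi>)" using that assms(2) unfolding perm_graphs_def by blast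
  qed
  then have "X \<subseteq> (\<Union>M\<in>?\<M>. Geom M)" by blast
  moreover have "\<forall>M\<in>?\<M>. is_grid_matrix M"
    by (auto simp: is_grid_matrix_def X_matrix_def)
  moreover have "finite ?\<M>" by simp
  ultimately show ?thesis
    unfolding geometrically_griddable_def by blast
qed

end
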